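(* (a) Suppose that $m$ is an even positive integer. Then there exist rational numbers $a\in[-1,1]$ such that $T_m(x)-a$ has a zero constructible over $\mathbb{Q}(a)=\mathbb{Q}$ but no zero in $\mathbb{Q}$. (b) Suppose $m$ is an odd positive integer, and let $a$ be any real number in $[-1,1]$. Then $T_m(x)-a$ has a zero that is constructible over $\mathbb{Q}(a)$ if and only if it has a zero in $\mathbb{Q}(a)$.
   Context: $T_m$ denotes the $m$-th Chebyshev polynomial of the first kind, the unique polynomial with $T_m(\cos\theta)=\cos(m\theta)$ for all real $\theta$. A real number is constructible over a subfield $F\subseteq\mathbb{R}$ if it can be obtained by unmarked straightedge-and-compass construction from $0,1$ and the elements of $F$; equivalently, it lies in the top of a finite tower $F=F_0\subset F_1\subset\dots\subset F_k\subset\mathbb{R}$ of quadratic extensions. *)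

theory Defs
  imports
    "HOL-Analysis.Analysis"
    "HOL-Computational_Algebra.Polynomial"
    "HOL-Algebra.Generated_Fields"
    "HOL-Algebra.Algebraic_Closure_Type"
begin

definition chebyshev_T :: "nat \<Rightarrow> real poly" where
  "chebyshev_T m = (THE p. \<forall>\<theta>::real. poly p (cos \<theta>) = cos (real m * \<theta>))"

lemma chebyshev_T_ex1: "\<exists>!p. \<forall>\<theta>::real. poly p (cos \<theta>) = cos (real m * \<theta>)"
proof (rule ex_ex1I)
  have "(\<exists>p. \<forall>\<theta>::real. poly p (cos \<theta>) = cos (real m * \<theta>)) \<and>
        (\<exists>q. \<forall>\<theta>::real. poly q (cos \<theta>) = cos (real (Suc m) * \<theta>))"
  proof (induction m)
    case 0
    have "poly 1 (cos \<theta>) = cos (real 0 * \<theta>)" "poly [:0, 1:] (cos \<theta>) = cos (real (Suc 0) * \<theta>)"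
      for \<theta> :: real by simp_all
    then show ?case by blast
  next
    case (Suc m)
    then obtain p q where
      p: "\<And>\<theta>::real. poly p (cos \<theta>) = cos (real m * \<theta>)" and
      q: "\<And>\<theta>::real. poly q (cos \<theta>) = cos (real (Suc m) * \<theta>)" by blast
    have "poly ([:0, 2:] * q - p) (cos \<theta>) = cos (real (Suc (Suc m)) * \<theta>)" for \<theta> :: real
    proof -
      have "cos \<theta> * cos (real (Suc m) * \<theta>) =
          (cos (\<theta> - real (Suc m) * \<theta>) + cos (\<theta> + real (Suc m) * \<theta>)) / 2"
        by (rule cos_times_cos)
      moreover have "cos (\<theta> - real (Suc m) * \<theta>) = cos (real m * \<theta>)"
        using cos_minus[of "real m * \<theta>"] by (simp add: algebra_simps)
      moreover have "\<theta> + real (Suc m) * \<theta> = real (Suc (Suc m)) * \<theta>"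
        by (simp add: algebra_simps)
      ultimately show ?thesis by (simp add: p q)
    qed
    with q show ?case by blast
  qed
  then show "\<exists>p. \<forall>\<theta>::real. poly p (cos \<theta>) = cos (real m * \<theta>)" ..
next
  fix p q :: "real poly"
  assume p: "\<forall>\<theta>::real. poly p (cos \<theta>) = cos (real m * \<theta>)"
    and q: "\<forall>\<theta>::real. poly q (cos \<theta>) = cos (real m * \<theta>)"
  have "x \<in> {x. poly (p - q) x = 0}" if "x \<in> {-1..1}" for x
    using p q that cos_arccos[of x] by (metis (mono_tags, lifting) atLeastAtMost_iff
      mem_Collect_eq poly_diff right_minus_eq)
  moreover have "infinite {-1..1::real}" by simp
  ultimately have "infinite {x. poly (p - q) x = 0}"
    by (meson finite_subset subsetI)
  then have "p - q = 0" using poly_roots_finite by blast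
  then show "p = q" by simp
qed

lemma poly_chebyshev_T_cos: "poly (chebyshev_T m) (cos \<theta>) = cos (real m * \<theta>)"
  using theI'[OF chebyshev_T_ex1, of m] unfolding chebyshev_T_def by blast

definition rat_adjoin :: "real \<Rightarrow> real set" where
  "rat_adjoin a = generate_field (ring_of_type_algebra :: real ring) {a}"

text \<open>
  The plane is the complex plane. A line is drawn through two distinct points already obtained, a
  circle about a point already obtained with radius the distance between two such points.
  The disequations in \<open>line_line\<close> and \<open>circle_circle\<close> are essential: coinciding lines or
  circles would make all of their points constructible.
\<close>

inductive_set constructible_points :: "complex set \<Rightarrow> complex set" for S where
  given: "z \<in> S \<Longrightarrow> z \<in> constructible_points S"
| line_line:
    "\<lbrakk>p \<in> constructible_points S; q \<in> constructible_points S; p \<noteq> q;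
      p' \<in> constructible_points S; q' \<in> constructible_points S; p' \<noteq> q';
      affine hull {p, q} \<noteq> affine hull {p', q'};
      z \<in> affine hull {p, q}; z \<in> affine hull {p', q'}\<rbrakk>
     \<Longrightarrow> z \<in> constructible_points S"
| line_circle:
    "\<lbrakk>p \<in> constructible_points S; q \<in> constructible_points S; p \<noteq> q;
      c \<in> constructible_points S; u \<in> constructible_points S; v \<in> constructible_points S;
      z \<in> affine hull {p, q}; z \<in> sphere c (dist u v)\<rbrakk>
     \<Longrightarrow> z \<in> constructible_points S"
| circle_circle:
    "\<lbrakk>c \<in> constructible_points S; u \<in> constructible_points S; v \<in> constructible_points S;
      c' \<in> constructible_points S; u' \<in> constructible_points S; v' \<in> constructible_points S;
      sphere c (dist u v) \<noteq> sphere c' (dist u' v');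
      z \<in> sphere c (dist u v); z \<in> sphere c' (dist u' v')\<rbrakk>
     \<Longrightarrow> z \<in> constructible_points S"

definition constructible_over :: "real set \<Rightarrow> real \<Rightarrow> bool" where
  "constructible_over F x \<longleftrightarrow>
     complex_of_real x \<in> constructible_points (complex_of_real ` ({0, 1} \<union> F))"

end

theory Submission
  imports Defs
begin

text \<open>
  For even \<open>m\<close> take \<open>a = 0\<close>: since \<open>T\<^sub>m = 2 T\<^bsub>m/2\<^esub>\<^sup>2 - 1\<close>, a rational zero would give a
  rational square root of \<open>1/2\<close>, while for \<open>m = 2\<^sup>e n\<close> with \<open>n\<close> odd the zero \<open>cos (\<pi> / 2\<^bsup>e+1\<^esup>)\<close> is
  obtained by repeated bisection of angles.

  For odd \<open>m\<close> a zero in the top of a tower of real quadratic extensions is pushed down one step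
  \<open>K(\<surd>d)\<close> at a time. The conjugate of a zero is again a real zero, and both lie in
  \<open>[-1, 1]\<close>, so the two can be written as \<open>cos (\<phi> - \<delta>)\<close> and \<open>cos (\<phi> + \<delta>)\<close>. As \<open>m\<close> is odd,
  \<open>\<delta>\<close> may be taken to be a multiple of \<open>2\<pi>/m\<close>, so that \<open>cos \<phi>\<close> is a zero as well. The trace
  and norm of the zero show that \<open>cos \<phi> cos \<delta>\<close> and \<open>cos\<^sup>2 \<phi> + cos\<^sup>2 \<delta>\<close> lie in \<open>K\<close>.
  If \<open>cos 2\<delta>\<close> lies in \<open>K\<close>, then so do \<open>cos \<delta>\<close> and the zero \<open>cos \<phi>\<close>. Otherwise
  \<open>cos 2\<phi>\<close> is the conjugate of \<open>cos 2\<delta>\<close> over \<open>K\<close>, so \<open>T\<^sub>m(cos 2\<phi>) = T\<^sub>m(cos 2\<delta>) = 1\<close>; this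
  forces \<open>a = \<plusminus>1\<close>, and then \<open>a\<close> itself is a zero.
\<close>

section \<open>Chebyshev polynomials\<close>

lemma chebyshev_T_eqI:
  assumes "\<And>\<theta>::real. poly p (cos \<theta>) = cos (real m * \<theta>)"
  shows "chebyshev_T m = p"
  using chebyshev_T_ex1[of m] assms poly_chebyshev_T_cos[of m] by blast

lemma chebyshev_T_0: "chebyshev_T 0 = 1"
  by (rule chebyshev_T_eqI) simp

lemma chebyshev_T_1: "chebyshev_T (Suc 0) = [:0, 1:]"
  by (rule chebyshev_T_eqI) simp

lemma chebyshev_T_Suc_Suc:
  "chebyshev_T (Suc (Suc n)) = [:0, 2:] * chebyshev_T (Suc n) - chebyshev_T n"
proof (rule chebyshev_T_eqI)
  fix \<theta> :: real
  have "cos (real (Suc (Suc n)) * \<theta>) + cos (real n * \<theta>) = 2 * cos \<theta> * cos (real (Suc n) * \<theta>)"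
    using cos_times_cos[of \<theta> "real (Suc n) * \<theta>"] cos_minus[of "real n * \<theta>"]
    by (simp add: algebra_simps)
  then show "poly ([:0, 2:] * chebyshev_T (Suc n) - chebyshev_T n) (cos \<theta>) =
      cos (real (Suc (Suc n)) * \<theta>)"
    unfolding poly_diff poly_mult poly_chebyshev_T_cos by simp
qed

lemma poly_chebyshev_T_Suc_Suc:
  "poly (chebyshev_T (Suc (Suc n))) x = 2 * x * poly (chebyshev_T (Suc n)) x - poly (chebyshev_T n) x"
  by (simp add: chebyshev_T_Suc_Suc)

lemma chebyshev_T_double: "chebyshev_T (2 * n) = 2 * chebyshev_T n ^ 2 - 1"
  by (rule chebyshev_T_eqI)
    (simp add: poly_chebyshev_T_cos poly_power cos_double_cos[symmetric] mult.assoc)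

text \<open>The recurrence gives |T_{n+2}(x)| \<ge> 2 |T_{n+1}(x)| - |T_n(x)| for |x| > 1, and by
  the induction hypothesis the subtracted term is smaller than |T_{n+1}(x)|.\<close>

lemma chebyshev_T_strict_growth:
  assumes "\<bar>x\<bar> > 1"
  shows "\<bar>poly (chebyshev_T n) x\<bar> < \<bar>poly (chebyshev_T (Suc n)) x\<bar>"
proof (induction n)
  case 0
  then show ?case using assms by (simp add: chebyshev_T_0 chebyshev_T_1)
next
  case (Suc n)
  let ?p = "poly (chebyshev_T n) x" and ?q = "poly (chebyshev_T (Suc n)) x"
  have "\<bar>?q\<bar> \<le> \<bar>x\<bar> * \<bar>?q\<bar>"
    using assms mult_right_mono[of 1 "\<bar>x\<bar>" "\<bar>?q\<bar>"] by simp
  moreover have "\<bar>2 * x * ?q\<bar> = 2 * (\<bar>x\<bar> * \<bar>?q\<bar>)"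
    by (simp add: abs_mult)
  ultimately show ?case
    unfolding poly_chebyshev_T_Suc_Suc using Suc by linarith
qed

text \<open>Outside [-1, 1] the values grow strictly in absolute value from |T_1(x)| = |x| > 1 on.
  Hence the real zeros of T_m - a with |a| \<le> 1, conjugate ones included, are cosines of real
  angles.\<close>

lemma chebyshev_T_bounded_imp_arg_bounded:
  assumes "m > 0" "\<bar>poly (chebyshev_T m) x\<bar> \<le> 1"
  shows "\<bar>x\<bar> \<le> 1"
proof (rule ccontr)
  assume "\<not> \<bar>x\<bar> \<le> 1"
  then have x: "\<bar>x\<bar> > 1" by simp
  have "\<bar>poly (chebyshev_T (Suc n)) x\<bar> > 1" for n
    by (induction n)
      (use x chebyshev_T_strict_growth[OF x] in \<open>auto simp: chebyshev_T_1 intro: less_trans\<close>)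
  with assms show False by (cases m) (force simp: not_less[symmetric])+
qed

section \<open>Real subfields and towers of quadratic extensions\<close>

locale real_subfield =
  fixes K :: "real set"
  assumes one_mem [simp]: "1 \<in> K"
    and add_mem [intro]: "x \<in> K \<Longrightarrow> y \<in> K \<Longrightarrow> x + y \<in> K"
    and uminus_mem [intro]: "x \<in> K \<Longrightarrow> - x \<in> K"
    and mult_mem [intro]: "x \<in> K \<Longrightarrow> y \<in> K \<Longrightarrow> x * y \<in> K"
    and inverse_mem [intro]: "x \<in> K \<Longrightarrow> inverse x \<in> K"
begin

lemma diff_mem [intro]: "x \<in> K \<Longrightarrow> y \<in> K \<Longrightarrow> x - y \<in> K"
  using add_mem[of x "- y"] by auto

lemma divide_mem [intro]: "x \<in> K \<Longrightarrow> y \<in> K \<Longrightarrow> x / y \<in> K"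
  by (auto simp: divide_inverse)

lemma zero_mem [simp]: "0 \<in> K"
  using diff_mem[of 1 1] by simp

lemma numeral_mem [simp]: "numeral n \<in> K"
  by (induction n) (auto simp only: one_mem numeral.simps intro!: add_mem)

lemma power_mem [intro]: "x \<in> K \<Longrightarrow> x ^ n \<in> K"
  by (induction n) auto

lemma poly_chebyshev_T_mem: "x \<in> K \<Longrightarrow> poly (chebyshev_T n) x \<in> K"
proof (induction n rule: induct_nat_012)
  case (ge2 n)
  then show ?case unfolding poly_chebyshev_T_Suc_Suc by (intro diff_mem mult_mem) auto
qed (auto simp: chebyshev_T_0 chebyshev_T_1)

text \<open>Stands in for the automorphism u + v s -> u - v s of K(s): the recurrence is run at both
  points at once, with the same coefficients A and B.\<close>

lemma poly_chebyshev_T_conj_decomp: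
  assumes "s\<^sup>2 \<in> K" "u \<in> K" "v \<in> K"
  shows "\<exists>A\<in>K. \<exists>B\<in>K. poly (chebyshev_T n) (u + v * s) = A + B * s \<and>
    poly (chebyshev_T n) (u - v * s) = A - B * s"
proof (induction n rule: induct_nat_012)
  case 0
  show ?case by (rule bexI[of _ 1], rule bexI[of _ 0]) (auto simp: chebyshev_T_0)
next
  case 1
  show ?case using assms by (auto simp: chebyshev_T_1)
next
  case (ge2 n)
  then obtain A B C D where AB: "A \<in> K" "B \<in> K" "C \<in> K" "D \<in> K"
    "poly (chebyshev_T n) (u + v * s) = A + B * s" "poly (chebyshev_T n) (u - v * s) = A - B * s"
    "poly (chebyshev_T (Suc n)) (u + v * s) = C + D * s"
    "poly (chebyshev_T (Suc n)) (u - v * s) = C - D * s"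
    by blast
  have "2 * (u * C + v * D * s\<^sup>2) - A \<in> K" "2 * (u * D + v * C) - B \<in> K"
    using AB assms by (auto intro!: diff_mem mult_mem add_mem)
  moreover have "poly (chebyshev_T (Suc (Suc n))) (u + v * s) =
      (2 * (u * C + v * D * s\<^sup>2) - A) + (2 * (u * D + v * C) - B) * s"
    "poly (chebyshev_T (Suc (Suc n))) (u - v * s) =
      (2 * (u * C + v * D * s\<^sup>2) - A) - (2 * (u * D + v * C) - B) * s"
    unfolding poly_chebyshev_T_Suc_Suc AB by Groebner_Basis.algebra+
  ultimately show ?case by blast
qed

text \<open>As s is not in K, a value A + B s in K forces B = 0. The root s is left general because
  the descent takes for it first \<open>sqrt d\<close> and then a difference of squared
  cosines.\<close>

lemma poly_chebyshev_T_conj: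
  assumes "s\<^sup>2 \<in> K" "s \<notin> K" "u \<in> K" "v \<in> K" "poly (chebyshev_T n) (u + v * s) \<in> K"
  shows "poly (chebyshev_T n) (u - v * s) = poly (chebyshev_T n) (u + v * s)"
proof -
  obtain A B where AB: "A \<in> K" "B \<in> K" "poly (chebyshev_T n) (u + v * s) = A + B * s"
    "poly (chebyshev_T n) (u - v * s) = A - B * s"
    using poly_chebyshev_T_conj_decomp[OF assms(1,3,4), of n] by blast
  have "B = 0"
  proof (rule ccontr)
    assume "B \<noteq> 0"
    then have "s = (poly (chebyshev_T n) (u + v * s) - A) / B" using AB by simp
    also have "\<dots> \<in> K" using AB(1,2) assms(5) by blast
    finally show False using assms(2) by contradiction
  qed
  with AB show ?thesis by simp
qed

end

text \<open>If \<open>sqrt d\<close> already lies in a field K, this is K itself, so towers may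
  contain trivial steps.\<close>

definition adjoin_sqrt :: "real set \<Rightarrow> real \<Rightarrow> real set" where
  "adjoin_sqrt K d = {u + v * sqrt d | u v. u \<in> K \<and> v \<in> K}"

lemma adjoin_sqrtI: "u \<in> K \<Longrightarrow> v \<in> K \<Longrightarrow> u + v * sqrt d \<in> adjoin_sqrt K d"
  by (auto simp: adjoin_sqrt_def)

context real_subfield
begin

lemma subset_adjoin_sqrt: "K \<subseteq> adjoin_sqrt K d"
  using adjoin_sqrtI[of _ K 0 d] by force

lemma sqrt_mem_adjoin_sqrt: "sqrt d \<in> adjoin_sqrt K d"
  using adjoin_sqrtI[of 0 K 1 d] by simp

lemma real_subfield_adjoin_sqrt:
  assumes "d \<in> K" "d \<ge> 0"
  shows "real_subfield (adjoin_sqrt K d)"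
proof
  show "1 \<in> adjoin_sqrt K d" using subset_adjoin_sqrt one_mem by blast
next
  fix x y assume "x \<in> adjoin_sqrt K d" "y \<in> adjoin_sqrt K d"
  then obtain u v u' v' where uv: "u \<in> K" "v \<in> K" "u' \<in> K" "v' \<in> K"
    "x = u + v * sqrt d" "y = u' + v' * sqrt d"
    by (auto simp: adjoin_sqrt_def)
  have "x + y = (u + u') + (v + v') * sqrt d" by (simp add: uv algebra_simps)
  then show "x + y \<in> adjoin_sqrt K d" using uv by (metis add_mem adjoin_sqrtI)
  have "x * y = (u * u' + v * v' * (sqrt d * sqrt d)) + (u * v' + v * u') * sqrt d"
    by (simp add: uv algebra_simps)
  then have "x * y = (u * u' + v * v' * d) + (u * v' + v * u') * sqrt d"
    using assms by simp
  then show "x * y \<in> adjoin_sqrt K d" using uv assms by (metis add_mem mult_mem adjoin_sqrtI)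
next
  fix x assume "x \<in> adjoin_sqrt K d"
  then obtain u v where uv: "u \<in> K" "v \<in> K" "x = u + v * sqrt d"
    by (auto simp: adjoin_sqrt_def)
  have "- x = (- u) + (- v) * sqrt d" by (simp add: uv)
  then show "- x \<in> adjoin_sqrt K d" using uv by (metis uminus_mem adjoin_sqrtI)
  show "inverse x \<in> adjoin_sqrt K d"
  \<comment> \<open>The conjugate of a nonzero x can vanish when \<open>sqrt d\<close> lies in K;
    then x = 2 u is in K. Otherwise the denominator is rationalised through the norm.\<close>
  proof (cases "u - v * sqrt d = 0")
    case True
    then have "x = 2 * u" by (simp add: uv)
    then have "inverse x \<in> K" using uv(1) by auto
    then show ?thesis using subset_adjoin_sqrt by blast
  next
    case False
    define N where "N = u\<^sup>2 - v\<^sup>2 * d"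
    have N: "N \<in> K" unfolding N_def using uv assms by (intro diff_mem mult_mem power_mem)
    have "N = x * (u - v * sqrt d)"
      using assms by (simp add: N_def uv algebra_simps power2_eq_square)
    then have "inverse x = (u - v * sqrt d) * inverse N"
      using False by simp
    also have "\<dots> = u * inverse N + (- v * inverse N) * sqrt d"
      by (simp add: algebra_simps)
    finally show ?thesis using uv N by (metis adjoin_sqrtI uminus_mem inverse_mem mult_mem)
  qed
qed

end

section \<open>Towers of real quadratic extensions and their union\<close>

inductive quadratic_tower :: "real set \<Rightarrow> real set \<Rightarrow> bool" for F where
  base: "quadratic_tower F F"
| step: "quadratic_tower F K \<Longrightarrow> d \<in> K \<Longrightarrow> d \<ge> 0 \<Longrightarrow> quadratic_tower F (adjoin_sqrt K d)"

lemma quadratic_tower_real_subfield: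
  "quadratic_tower F K \<Longrightarrow> real_subfield F \<Longrightarrow> real_subfield K"
  by (induction rule: quadratic_tower.induct) (auto intro: real_subfield.real_subfield_adjoin_sqrt)

lemma quadratic_tower_subset:
  "quadratic_tower F K \<Longrightarrow> real_subfield F \<Longrightarrow> F \<subseteq> K"
  by (induction rule: quadratic_tower.induct)
    (use quadratic_tower_real_subfield real_subfield.subset_adjoin_sqrt in blast)+

lemma quadratic_tower_trans:
  "quadratic_tower K L \<Longrightarrow> quadratic_tower F K \<Longrightarrow> quadratic_tower F L"
  by (induction rule: quadratic_tower.induct) (auto intro: quadratic_tower.intros)

text \<open>The same radicands are adjoined in the same order over the larger base.\<close>

lemma quadratic_tower_lift:
  "quadratic_tower F K \<Longrightarrow> F \<subseteq> F' \<Longrightarrow> \<exists>K'. quadratic_tower F' K' \<and> K \<subseteq> K'"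
proof (induction rule: quadratic_tower.induct)
  case base
  then show ?case using quadratic_tower.base by blast
next
  case (step K d)
  then obtain K' where "quadratic_tower F' K'" "K \<subseteq> K'" by blast
  moreover from this have "adjoin_sqrt K d \<subseteq> adjoin_sqrt K' d"
    by (auto simp: adjoin_sqrt_def)
  ultimately show ?case using step.hyps quadratic_tower.step by (metis subsetD)
qed

definition quadratic_closure :: "real set \<Rightarrow> real set" where
  "quadratic_closure F = \<Union> {K. quadratic_tower F K}"

text \<open>One tower is lifted over the top of the other and the two are stacked. This directedness
  is what makes the union a field.\<close>

lemma quadratic_closure_common_tower:
  assumes "real_subfield F" "x \<in> quadratic_closure F" "y \<in> quadratic_closure F"
  obtains K where "quadratic_tower F K" "x \<in> K" "y \<in> K"
proof -
  obtain K L where KL: "quadratic_tower F K" "x \<in> K" "quadratic_tower F L" "y \<in> L"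
    using assms by (auto simp: quadratic_closure_def)
  obtain L' where "quadratic_tower K L'" "L \<subseteq> L'"
    using quadratic_tower_lift[OF KL(3) quadratic_tower_subset[OF KL(1) assms(1)]] by blast
  with KL that[of L'] quadratic_tower_trans quadratic_tower_subset quadratic_tower_real_subfield assms
  show thesis by blast
qed

lemma subset_quadratic_closure: "F \<subseteq> quadratic_closure F"
  using quadratic_tower.base by (auto simp: quadratic_closure_def)

lemma real_subfield_quadratic_closure:
  assumes "real_subfield F"
  shows "real_subfield (quadratic_closure F)"
proof
  show "1 \<in> quadratic_closure F"
    using subset_quadratic_closure real_subfield.one_mem[OF assms] by blast
next
  fix x y assume "x \<in> quadratic_closure F" "y \<in> quadratic_closure F"
  then obtain K where K: "quadratic_tower F K" "x \<in> K" "y \<in> K"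
    using quadratic_closure_common_tower assms by blast
  interpret real_subfield K using K assms quadratic_tower_real_subfield by blast
  show "x + y \<in> quadratic_closure F" "x * y \<in> quadratic_closure F"
    using K by (auto simp: quadratic_closure_def)
next
  fix x assume "x \<in> quadratic_closure F"
  then obtain K where K: "quadratic_tower F K" "x \<in> K"
    by (auto simp: quadratic_closure_def)
  interpret real_subfield K using K assms quadratic_tower_real_subfield by blast
  show "- x \<in> quadratic_closure F" "inverse x \<in> quadratic_closure F"
    using K by (auto simp: quadratic_closure_def)
qed

lemma sqrt_mem_quadratic_closure:
  assumes "real_subfield F" "d \<in> quadratic_closure F" "d \<ge> 0"
  shows "sqrt d \<in> quadratic_closure F"
proof -
  obtain K where K: "quadratic_tower F K" "d \<in> K"
    using assms by (auto simp: quadratic_closure_def)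
  interpret real_subfield K using K assms quadratic_tower_real_subfield by blast
  show ?thesis
    using quadratic_tower.step[OF K assms(3)] sqrt_mem_adjoin_sqrt
    by (auto simp: quadratic_closure_def)
qed

section \<open>Ruler and compass constructions stay in the quadratic closure\<close>

locale euclidean_subfield = real_subfield +
  assumes sqrt_mem [intro]: "x \<in> K \<Longrightarrow> x \<ge> 0 \<Longrightarrow> sqrt x \<in> K"
begin

text \<open>Completing the square shows that the discriminant is (2 a t + b)^2. It is thus
  nonnegative, and its square root in K is 2 a t + b up to sign.\<close>

lemma quadratic_root_mem:
  assumes "a \<in> K" "b \<in> K" "c \<in> K" "a \<noteq> 0" "a * t\<^sup>2 + b * t + c = 0"
  shows "t \<in> K"
proof -
  have sq: "(2 * a * t + b)\<^sup>2 = b\<^sup>2 - 4 * a * c"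
    using assms(5) by Groebner_Basis.algebra
  have "sqrt (b\<^sup>2 - 4 * a * c) \<in> K"
    using sq[symmetric] assms(1-3) by (intro sqrt_mem diff_mem power_mem mult_mem) auto
  then have "\<bar>2 * a * t + b\<bar> \<in> K" by (simp add: sq[symmetric])
  then have "2 * a * t + b \<in> K"
    by (metis abs_if minus_minus uminus_mem)
  then have "(2 * a * t + b - b) / (2 * a) \<in> K" using assms(1,2) by (intro divide_mem diff_mem) auto
  then show ?thesis using assms(4) by simp
qed

definition plane :: "complex set" where
  "plane = {z. Re z \<in> K \<and> Im z \<in> K}"

lemma plane_iff: "z \<in> plane \<longleftrightarrow> Re z \<in> K \<and> Im z \<in> K"
  by (simp add: plane_def)

lemma dist_square_mem: "u \<in> plane \<Longrightarrow> v \<in> plane \<Longrightarrow> (dist u v)\<^sup>2 \<in> K"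
  by (auto simp: plane_iff dist_norm cmod_power2)

end

lemma affine_hull_pair_iff:
  fixes p q z :: "'a::real_vector"
  shows "z \<in> affine hull {p, q} \<longleftrightarrow> (\<exists>t. z = p + t *\<^sub>R (q - p))"
proof -
  have "u *\<^sub>R p + v *\<^sub>R q = p + v *\<^sub>R (q - p)" if "u + v = 1" for u v
  proof -
    have u: "u = 1 - v" using that by simp
    show ?thesis unfolding u by (simp add: algebra_simps)
  qed
  moreover have "(1 - t) *\<^sub>R p + t *\<^sub>R q = p + t *\<^sub>R (q - p)" for t
    by (simp add: algebra_simps)
  ultimately show ?thesis
    unfolding affine_hull_2 by (smt (verit, best) mem_Collect_eq)
qed

lemma mem_sphere_complex_iff:
  "z \<in> sphere c r \<longleftrightarrow> r \<ge> 0 \<and> (Re z - Re c)\<^sup>2 + (Im z - Im c)\<^sup>2 = r\<^sup>2" for z c :: complex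
proof -
  have "z \<in> sphere c r \<longleftrightarrow> r \<ge> 0 \<and> (dist c z)\<^sup>2 = r\<^sup>2"
    using power2_eq_iff_nonneg[of "dist c z" r] by auto
  also have "(dist c z)\<^sup>2 = (Re z - Re c)\<^sup>2 + (Im z - Im c)\<^sup>2"
    by (simp add: dist_norm cmod_power2 power2_commute)
  finally show ?thesis .
qed

text \<open>The vanishing determinant makes the directions parallel, and z is a common point.
  Exchanging the two lines yields the other inclusion.\<close>

lemma affine_hull_pair_subset:
  fixes p q p' q' z :: complex
  assumes "p' \<noteq> q'" "z \<in> affine hull {p, q}" "z \<in> affine hull {p', q'}"
    "(Re q - Re p) * (Im q' - Im p') = (Im q - Im p) * (Re q' - Re p')"
  shows "affine hull {p, q} \<subseteq> affine hull {p', q'}"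
proof
  fix w assume "w \<in> affine hull {p, q}"
  then obtain t where t: "w = p + t *\<^sub>R (q - p)" by (auto simp: affine_hull_pair_iff)
  obtain t0 t1 where z: "z = p + t0 *\<^sub>R (q - p)" "z = p' + t1 *\<^sub>R (q' - p')"
    using assms unfolding affine_hull_pair_iff by blast
  have "\<exists>r. q - p = r *\<^sub>R (q' - p')"
  proof (cases "Re q' = Re p'")
    case True
    then have "Im q' \<noteq> Im p'" using assms(1) by (auto simp: complex_eq_iff)
    with True assms(4) show ?thesis
      by (intro exI[of _ "(Im q - Im p) / (Im q' - Im p')"]) (auto simp: complex_eq_iff)
  next
    case False
    with assms(4) show ?thesis
      by (intro exI[of _ "(Re q - Re p) / (Re q' - Re p')"]) (simp add: complex_eq_iff nonzero_eq_divide_eq)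
  qed
  then obtain r where r: "q - p = r *\<^sub>R (q' - p')" by blast
  have "w = z + (t - t0) *\<^sub>R (q - p)" by (simp add: t z(1) algebra_simps)
  also have "\<dots> = p' + (t1 + (t - t0) * r) *\<^sub>R (q' - p')"
    by (simp add: z(2) r scaleR_add_left)
  finally show "w \<in> affine hull {p', q'}" unfolding affine_hull_pair_iff by blast
qed

context euclidean_subfield
begin

text \<open>Distinct lines with a common point are not parallel, so the determinant D is nonzero and
  Cramer's rule gives the parameter t inside K.\<close>

lemma line_line_mem_plane:
  assumes "p \<in> plane" "q \<in> plane" "p \<noteq> q" "p' \<in> plane" "q' \<in> plane" "p' \<noteq> q'"
    "affine hull {p, q} \<noteq> affine hull {p', q'}"
    "z \<in> affine hull {p, q}" "z \<in> affine hull {p', q'}"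
  shows "z \<in> plane"
proof -
  define D where "D = (Re q - Re p) * (Im q' - Im p') - (Im q - Im p) * (Re q' - Re p')"
  have "D \<noteq> 0"
  proof
    assume D: "D = 0"
    have "affine hull {p, q} \<subseteq> affine hull {p', q'}"
      using D assms by (intro affine_hull_pair_subset) (auto simp: D_def)
    moreover have "affine hull {p', q'} \<subseteq> affine hull {p, q}"
      using D assms by (intro affine_hull_pair_subset) (auto simp: D_def algebra_simps)
    ultimately show False using assms by blast
  qed
  obtain t t' where z: "z = p + t *\<^sub>R (q - p)" "z = p' + t' *\<^sub>R (q' - p')"
    using assms unfolding affine_hull_pair_iff by blast
  have re: "Re p + t * (Re q - Re p) = Re p' + t' * (Re q' - Re p')"
    and im: "Im p + t * (Im q - Im p) = Im p' + t' * (Im q' - Im p')"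
    using arg_cong[OF z(2)[unfolded z(1)], of Re] arg_cong[OF z(2)[unfolded z(1)], of Im] by simp_all
  have "t * D = (Re p' - Re p) * (Im q' - Im p') - (Im p' - Im p) * (Re q' - Re p')"
    using re im unfolding D_def by Groebner_Basis.algebra
  then have "t = ((Re p' - Re p) * (Im q' - Im p') - (Im p' - Im p) * (Re q' - Re p')) / D"
    using \<open>D \<noteq> 0\<close> by (simp add: field_simps)
  also have "\<dots> \<in> K" unfolding D_def using assms by (auto simp: plane_iff)
  finally show ?thesis using assms by (auto simp: z(1) plane_iff)
qed

text \<open>Substituting the parametrised line into the circle equation gives a quadratic equation
  for t over K, with leading coefficient |q - p|^2.\<close>

lemma line_circle_mem_plane:
  assumes "p \<in> plane" "q \<in> plane" "p \<noteq> q" "c \<in> plane" "r\<^sup>2 \<in> K"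
    "z \<in> affine hull {p, q}" "z \<in> sphere c r"
  shows "z \<in> plane"
proof -
  obtain t where z: "z = p + t *\<^sub>R (q - p)"
    using assms unfolding affine_hull_pair_iff by blast
  define A where "A = (Re q - Re p)\<^sup>2 + (Im q - Im p)\<^sup>2"
  define B where "B = 2 * ((Re q - Re p) * (Re p - Re c) + (Im q - Im p) * (Im p - Im c))"
  define E where "E = (Re p - Re c)\<^sup>2 + (Im p - Im c)\<^sup>2 - r\<^sup>2"
  have "A \<in> K" "B \<in> K" "E \<in> K"
    unfolding A_def B_def E_def using assms
    by (auto simp: plane_iff intro!: add_mem diff_mem mult_mem power_mem)
  moreover have "A \<noteq> 0"
    using assms(3) by (auto simp: A_def sum_power2_eq_zero_iff complex_eq_iff)
  moreover have "A * t\<^sup>2 + B * t + E = 0"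
  proof -
    have "(Re p + t * (Re q - Re p) - Re c)\<^sup>2 + (Im p + t * (Im q - Im p) - Im c)\<^sup>2 = r\<^sup>2"
      using assms(7) unfolding mem_sphere_complex_iff z by simp
    then show ?thesis unfolding A_def B_def E_def by Groebner_Basis.algebra
  qed
  ultimately have "t \<in> K" by (rule quadratic_root_mem)
  then show ?thesis using assms by (auto simp: z plane_iff)
qed

text \<open>The radical axis reduces the intersection of two circles to that of a line and a circle.\<close>

lemma circle_circle_mem_plane:
  assumes "c \<in> plane" "r\<^sup>2 \<in> K" "c' \<in> plane" "r'\<^sup>2 \<in> K"
    "sphere c r \<noteq> sphere c' r'" "z \<in> sphere c r" "z \<in> sphere c' r'"
  shows "z \<in> plane"
proof -
  have r: "r = dist c z" "r' = dist c' z" using assms by auto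
  \<comment> \<open>Both circles pass through z, so with equal centres they would coincide.\<close>
  then have "c \<noteq> c'" using assms by auto
  define a where "a = Re c' - Re c"
  define b where "b = Im c' - Im c"
  define N where "N = a\<^sup>2 + b\<^sup>2"
  define k where "k = (r\<^sup>2 - r'\<^sup>2 + (Re c')\<^sup>2 - (Re c)\<^sup>2 + (Im c')\<^sup>2 - (Im c)\<^sup>2) / 2"
  have ab: "a \<in> K" "b \<in> K" using assms by (auto simp: a_def b_def plane_iff)
  then have N: "N \<in> K" by (auto simp: N_def)
  have k: "k \<in> K" unfolding k_def using assms
    by (auto simp: plane_iff intro!: add_mem diff_mem divide_mem power_mem)
  have N0: "N \<noteq> 0"
    using \<open>c \<noteq> c'\<close> by (auto simp: N_def a_def b_def sum_power2_eq_zero_iff complex_eq_iff)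
  have s: "(Re z - Re c)\<^sup>2 + (Im z - Im c)\<^sup>2 = r\<^sup>2" "(Re z - Re c')\<^sup>2 + (Im z - Im c')\<^sup>2 = r'\<^sup>2"
    using assms(6,7) by (simp_all only: mem_sphere_complex_iff)
  have lin: "a * Re z + b * Im z = k"
  proof -
    have "2 * (a * Re z + b * Im z) = r\<^sup>2 - r'\<^sup>2 + (Re c')\<^sup>2 - (Re c)\<^sup>2 + (Im c')\<^sup>2 - (Im c)\<^sup>2"
      using s unfolding a_def b_def by Groebner_Basis.algebra
    then show ?thesis by (simp add: k_def)
  qed
  \<comment> \<open>The radical axis is a x + b y = k. Its point nearest to the origin is p, and q -
    p is its direction (-b, a).\<close>
  define p where "p = Complex (k * a / N) (k * b / N)"
  define q where "q = Complex (k * a / N - b) (k * b / N + a)"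
  define t where "t = (a * Im z - b * Re z) / N"
  have p: "p \<in> plane" and q: "q \<in> plane" using ab N k by (auto simp: p_def q_def plane_iff)
  have pq: "p \<noteq> q" using N0 by (auto simp: p_def q_def N_def complex_eq_iff)
  have "z = p + t *\<^sub>R (q - p)"
  proof -
    have Nt: "N * t = a * Im z - b * Re z" using N0 by (simp add: t_def)
    have "N * Re z = k * a - N * (t * b)" "N * Im z = k * b + N * (t * a)"
      using Nt unfolding lin[symmetric] N_def by Groebner_Basis.algebra+
    then have "Re z = (k * a - N * (t * b)) / N" "Im z = (k * b + N * (t * a)) / N"
      using N0 by (metis nonzero_mult_div_cancel_left)+
    then have "Re z = k * a / N - t * b" "Im z = k * b / N + t * a"
      using N0 by (simp_all add: diff_divide_distrib add_divide_distrib)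
    then show ?thesis by (simp add: complex_eq_iff p_def q_def)
  qed
  then have z: "z \<in> affine hull {p, q}" unfolding affine_hull_pair_iff by blast
  show ?thesis by (rule line_circle_mem_plane[OF p q pq assms(1,2) z assms(6)])
qed

lemma constructible_points_subset_plane:
  assumes "S \<subseteq> plane"
  shows "constructible_points S \<subseteq> plane"
proof
  fix z assume "z \<in> constructible_points S"
  then show "z \<in> plane"
  proof induction
    case (given z)
    then show ?case using assms by blast
  next
    case (line_line p q p' q' z)
    then show ?case using line_line_mem_plane by blast
  next
    case (line_circle p q c u v z)
    then show ?case using line_circle_mem_plane dist_square_mem by blast
  next
    case (circle_circle c u v c' u' v' z)
    then show ?case using circle_circle_mem_plane dist_square_mem by blast
  qed
qed

end

text \<open>Translates geometry into algebra: the quadratic closure is a Euclidean field, so no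
  construction step leaves the plane over it.\<close>

lemma constructible_over_mem_quadratic_closure:
  assumes "real_subfield F" "constructible_over F x"
  shows "x \<in> quadratic_closure F"
proof -
  interpret F: real_subfield F by fact
  interpret euclidean_subfield "quadratic_closure F"
    using real_subfield_quadratic_closure[OF assms(1)] sqrt_mem_quadratic_closure[OF assms(1)]
    by (auto simp: euclidean_subfield_def euclidean_subfield_axioms_def)
  have "complex_of_real ` ({0, 1} \<union> F) \<subseteq> plane"
    using subset_quadratic_closure[of F] by (auto simp: plane_iff)
  then have "complex_of_real x \<in> plane"
    using constructible_points_subset_plane assms(2) unfolding constructible_over_def by blast
  then show ?thesis by (simp add: plane_iff)
qed

section \<open>Descent of a zero along a quadratic extension\<close>

text \<open>Equality of the cosines gives an angle with cosine \<open>cos \<theta>'\<close> whose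
  m-fold differs from m \<theta> by 2 j pi. Adding 2 pi to it changes j by the odd number m, so j
  can be made even; half the difference of the angles is then still a multiple of 2 pi / m.\<close>

lemma cos_mult_eq_imp_even_shift:
  assumes "odd m" "cos (real m * \<theta>) = cos (real m * \<theta>')"
  obtains \<psi> and k :: int where "cos \<psi> = cos \<theta>'" "real m * \<psi> = real m * \<theta> + 4 * of_int k * pi"
proof -
  obtain n where n: "n \<in> \<int>"
    "real m * \<theta> = real m * \<theta>' + 2 * n * pi \<or> real m * \<theta> = - (real m * \<theta>') + 2 * n * pi"
    using assms(2) unfolding cos_eq by blast
  then obtain i :: int where i: "n = of_int i" by (auto elim: Ints_cases)
  obtain \<alpha> and j :: int where \<alpha>: "cos \<alpha> = cos \<theta>'" "real m * \<alpha> = real m * \<theta> + 2 * of_int j * pi"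
  proof (cases "real m * \<theta> = real m * \<theta>' + 2 * n * pi")
    case True
    then show ?thesis using that[of \<theta>' "- i"] i by simp
  next
    case False
    then show ?thesis using that[of "- \<theta>'" "- i"] i n by simp
  qed
  show thesis
  proof (cases "even j")
    case True
    then obtain k where "j = 2 * k" by (elim evenE)
    then show thesis using that[of \<alpha> k] \<alpha> by simp
  next
    case False
    then have "even (j + int m)" using assms(1) by simp
    then obtain k where k: "j + int m = 2 * k" by (elim evenE)
    have "real_of_int j + real m = 2 * real_of_int k"
      using arg_cong[OF k, of real_of_int] by simp
    then have "2 * real_of_int j * pi + 2 * real m * pi = 4 * of_int k * pi"
      by Groebner_Basis.algebra
    then have "real m * (\<alpha> + 2 * pi) = real m * \<theta> + 4 * of_int k * pi"
      using \<alpha>(2) by (simp add: distrib_left)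
    then show thesis using that[of "\<alpha> + 2 * pi" k] \<alpha>(1) by simp
  qed
qed

lemma cos_odd_mult_half_pi: "odd m \<Longrightarrow> cos (real m * (pi / 2)) = 0"
  by (auto elim!: oddE simp: algebra_simps add_divide_distrib cos_add)

lemma cos_sin_int_mult_2pi: "cos (2 * of_int k * pi) = 1" "sin (2 * of_int k * pi) = 0"
  using cos_int_2pin[of k] sin_int_2pin[of k] by (simp_all add: mult_ac)

text \<open>With m = 2 n + 1, the angle (n + 1) (2 \<delta>) is \<delta> modulo 2 pi, so cos
  \<delta> = T_{n+1}(cos 2\<delta>). If cos \<delta> were 0, then cos (m \<delta>) = 1 would equal
  T_m(0) = 0.\<close>

lemma (in real_subfield) cos_mem_of_cos_double_mem:
  assumes "odd m" "real m * \<delta> = 2 * of_int k * pi" "cos (2 * \<delta>) \<in> K"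
  shows "cos \<delta> \<in> K" "cos \<delta> \<noteq> 0"
proof -
  obtain n where n: "m = 2 * n + 1" using assms(1) by (elim oddE)
  have "real (n + 1) * (2 * \<delta>) = \<delta> + 2 * of_int k * pi"
    using assms(2) by (simp add: n algebra_simps)
  then have "cos \<delta> = cos (real (n + 1) * (2 * \<delta>))"
    by (simp add: cos_add cos_sin_int_mult_2pi)
  also have "\<dots> = poly (chebyshev_T (n + 1)) (cos (2 * \<delta>))" by (simp only: poly_chebyshev_T_cos)
  finally show "cos \<delta> \<in> K" using poly_chebyshev_T_mem assms(3) by simp
  show "cos \<delta> \<noteq> 0"
  proof
    assume "cos \<delta> = 0"
    then have "cos (real m * \<delta>) = cos (real m * (pi / 2))"
      by (simp only: poly_chebyshev_T_cos[symmetric] cos_pi_half)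
    then show False unfolding assms(2) cos_odd_mult_half_pi[OF assms(1)] cos_sin_int_mult_2pi by simp
  qed
qed

lemma odd_chebyshev_T_unit:
  assumes "odd m" "a = 1 \<or> a = -1"
  shows "poly (chebyshev_T m) a = a"
  using assms poly_chebyshev_T_cos[of m 0] poly_chebyshev_T_cos[of m pi] by auto

lemma (in real_subfield) chebyshev_T_zero_descent:
  assumes "odd m" "a \<in> K" "\<bar>a\<bar> \<le> 1" "d \<in> K" "d \<ge> 0"
    "x \<in> adjoin_sqrt K d" "poly (chebyshev_T m) x = a"
  shows "\<exists>y\<in>K. poly (chebyshev_T m) y = a"
\<comment> \<open>Either the extension is trivial or a is its own zero. The remaining case has a
  genuine conjugation, and a^2 \<noteq> 1 for the contradiction below.\<close>
proof (cases "sqrt d \<in> K \<or> a = 1 \<or> a = -1")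
  case True
  then show ?thesis
  proof
    assume "sqrt d \<in> K"
    then have "x \<in> K" using assms(6) by (auto simp: adjoin_sqrt_def)
    with assms show ?thesis by blast
  next
    assume "a = 1 \<or> a = -1"
    with odd_chebyshev_T_unit assms show ?thesis by blast
  qed
next
  case False
  have m: "m > 0" using assms(1) by (simp add: odd_pos)
  obtain u v where uv: "u \<in> K" "v \<in> K" "x = u + v * sqrt d"
    using assms(6) by (auto simp: adjoin_sqrt_def)
  define x' where "x' = u - v * sqrt d"
  have x': "poly (chebyshev_T m) x' = a"
    using poly_chebyshev_T_conj[of "sqrt d" u v m] False assms uv by (simp add: x'_def)
  have "\<bar>x\<bar> \<le> 1" "\<bar>x'\<bar> \<le> 1"
    using chebyshev_T_bounded_imp_arg_bounded[OF m] assms x' by auto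
  then have cx: "cos (arccos x) = x" "cos (arccos x') = x'" by (simp_all add: cos_arccos_abs)
  define \<theta> where "\<theta> = arccos x"
  have "cos (real m * arccos x) = cos (real m * arccos x')"
    using assms(7) x' cx poly_chebyshev_T_cos[of m "arccos x"] poly_chebyshev_T_cos[of m "arccos x'"]
    by simp
  then obtain \<psi> and k :: int
    where \<psi>: "cos \<psi> = x'" "real m * \<psi> = real m * \<theta> + 4 * of_int k * pi"
    using cos_mult_eq_imp_even_shift[OF assms(1)] cx \<theta>_def by metis
  \<comment> \<open>Half the difference and half the sum of the angles: the even shift makes m
    \<delta> a multiple of 2 pi and m \<phi> congruent to m \<theta>.\<close>
  define \<delta> where "\<delta> = (\<psi> - \<theta>) / 2"
  define \<phi> where "\<phi> = (\<psi> + \<theta>) / 2"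
  have m\<delta>: "real m * \<delta> = 2 * of_int k * pi" and m\<phi>: "real m * \<phi> = real m * \<theta> + 2 * of_int k * pi"
    using \<psi>(2) by (simp_all add: \<delta>_def \<phi>_def algebra_simps add_divide_distrib diff_divide_distrib)
  have ang: "\<theta> = \<phi> - \<delta>" "\<psi> = \<phi> + \<delta>" by (simp_all add: \<delta>_def \<phi>_def field_simps)
  have x_eq: "x = cos \<phi> * cos \<delta> + sin \<phi> * sin \<delta>" "x' = cos \<phi> * cos \<delta> - sin \<phi> * sin \<delta>"
    using cx(1) \<psi>(1) unfolding \<theta>_def[symmetric] ang by (simp_all add: cos_add cos_diff)
  have cos_m\<phi>: "cos (real m * \<phi>) = a"
    using assms(7) cx(1) poly_chebyshev_T_cos[of m \<theta>]
    by (simp add: m\<phi> cos_add cos_sin_int_mult_2pi \<theta>_def)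
  have u: "u = cos \<phi> * cos \<delta>" using x_eq uv(3) x'_def by simp
  \<comment> \<open>Here \<sigma> - 1 is the norm x x', and r^2 is the discriminant of the quadratic
    over K with roots cos^2 \<delta> and cos^2 \<phi>, whose product is u^2.\<close>
  define r where "r = (cos \<delta>)\<^sup>2 - (cos \<phi>)\<^sup>2"
  define \<sigma> where "\<sigma> = (cos \<delta>)\<^sup>2 + (cos \<phi>)\<^sup>2"
  have "\<sigma> = x * x' + 1"
    using sin_cos_squared_add[of \<phi>] sin_cos_squared_add[of \<delta>] unfolding x_eq \<sigma>_def by Groebner_Basis.algebra
  also have "x * x' = u\<^sup>2 - v\<^sup>2 * d"
    using assms(5) by (simp add: uv(3) x'_def algebra_simps power2_eq_square)
  finally have \<sigma>: "\<sigma> \<in> K"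
    using uv assms(4) by (auto intro!: add_mem diff_mem mult_mem power_mem)
  have "r\<^sup>2 = \<sigma>\<^sup>2 - 4 * u\<^sup>2" unfolding u r_def \<sigma>_def by Groebner_Basis.algebra
  then have r2: "r\<^sup>2 \<in> K" using \<sigma> uv(1) by (auto intro!: diff_mem mult_mem power_mem)
  \<comment> \<open>The explicit factor 1 matches the shape u + v s in
    \<open>poly_chebyshev_T_conj\<close>, with s = r.\<close>
  have dbl: "cos (2 * \<delta>) = (\<sigma> - 1) + 1 * r" "cos (2 * \<phi>) = (\<sigma> - 1) - 1 * r"
    by (simp_all add: cos_double_cos \<sigma>_def r_def)
  have "r \<in> K"
  proof (rule ccontr)
    assume r: "r \<notin> K"
    have "real m * (2 * \<delta>) = 2 * of_int (2 * k) * pi"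
      unfolding mult.left_commute[of _ 2] m\<delta> by simp
    then have one: "poly (chebyshev_T m) (cos (2 * \<delta>)) = 1"
      by (simp only: poly_chebyshev_T_cos cos_sin_int_mult_2pi)
    have "poly (chebyshev_T m) (cos (2 * \<phi>)) = 1"
      using poly_chebyshev_T_conj[OF r2 r, of "\<sigma> - 1" 1 m] one diff_mem[OF \<sigma> one_mem]
      unfolding dbl by simp
    \<comment> \<open>Since cos (m \<phi>) = a, the duplication formula turns this into 2 a^2 - 1 =
      1.\<close>
    then have "cos (2 * (real m * \<phi>)) = 1" by (simp add: poly_chebyshev_T_cos mult_ac)
    then have "a\<^sup>2 = 1" by (simp only: cos_double_cos cos_m\<phi>)
    with False show False by (simp add: power2_eq_1_iff)
  qed
  then have "cos (2 * \<delta>) \<in> K" unfolding dbl using \<sigma> by (intro add_mem diff_mem) auto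
  then have "cos \<delta> \<in> K" "cos \<delta> \<noteq> 0" using cos_mem_of_cos_double_mem[OF assms(1) m\<delta>] by auto
  then have "cos \<phi> = u / cos \<delta>" "u / cos \<delta> \<in> K"
    using u divide_mem[OF uv(1), of "cos \<delta>"] by simp_all
  then show ?thesis using cos_m\<phi> poly_chebyshev_T_cos by metis
qed

lemma quadratic_tower_chebyshev_T_zero_descent:
  assumes "quadratic_tower F K" "real_subfield F" "odd m" "a \<in> F" "\<bar>a\<bar> \<le> 1"
    "\<exists>x\<in>K. poly (chebyshev_T m) x = a"
  shows "\<exists>x\<in>F. poly (chebyshev_T m) x = a"
  using assms
proof (induction rule: quadratic_tower.induct)
  case (step K d)
  interpret real_subfield K using step quadratic_tower_real_subfield by blast
  have "a \<in> K" using step quadratic_tower_subset by blast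
  with step chebyshev_T_zero_descent show ?case by blast
qed

section \<open>Fields generated by one real number\<close>

lemma ring_of_type_algebra_real_simps:
  "\<one>\<^bsub>(ring_of_type_algebra :: real ring)\<^esub> = 1"
  "\<zero>\<^bsub>(ring_of_type_algebra :: real ring)\<^esub> = 0"
  "x \<oplus>\<^bsub>(ring_of_type_algebra :: real ring)\<^esub> y = x + y"
  "x \<otimes>\<^bsub>(ring_of_type_algebra :: real ring)\<^esub> y = x * y"
  "carrier (ring_of_type_algebra :: real ring) = UNIV"
  by (simp_all add: ring_of_type_algebra_def)

lemma a_inv_ring_of_type_algebra_real: "\<ominus>\<^bsub>(ring_of_type_algebra :: real ring)\<^esub> x = - x"
proof -
  interpret R: field "ring_of_type_algebra :: real ring" by rule
  show ?thesis
    using R.l_neg[of x] by (simp add: ring_of_type_algebra_real_simps)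
qed

text \<open>At 0 the record inverse is a description without a witness, whereas
  \<open>inverse 0 = 0\<close>.\<close>

lemma m_inv_ring_of_type_algebra_real:
  assumes "x \<noteq> 0"
  shows "inv\<^bsub>(ring_of_type_algebra :: real ring)\<^esub> x = inverse x"
proof -
  interpret R: field "ring_of_type_algebra :: real ring" by rule
  show ?thesis
    using assms
    by (intro R.comm_inv_char) (simp_all add: ring_of_type_algebra_real_simps)
qed

lemma mem_rat_adjoin: "a \<in> rat_adjoin a"
  unfolding rat_adjoin_def by (rule generate_field.incl) simp

lemma real_subfield_rat_adjoin: "real_subfield (rat_adjoin a)"
proof
  show one: "1 \<in> rat_adjoin a"
    using generate_field.one[of "ring_of_type_algebra :: real ring"]
    by (simp add: rat_adjoin_def ring_of_type_algebra_real_simps)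
  show add: "x + y \<in> rat_adjoin a" if "x \<in> rat_adjoin a" "y \<in> rat_adjoin a" for x y
    using generate_field.eng_add[of x "ring_of_type_algebra :: real ring"] that
    by (simp add: rat_adjoin_def ring_of_type_algebra_real_simps)
  show "x * y \<in> rat_adjoin a" if "x \<in> rat_adjoin a" "y \<in> rat_adjoin a" for x y
    using generate_field.eng_mult[of x "ring_of_type_algebra :: real ring"] that
    by (simp add: rat_adjoin_def ring_of_type_algebra_real_simps)
  show uminus: "- x \<in> rat_adjoin a" if "x \<in> rat_adjoin a" for x
    using generate_field.a_inv[of x "ring_of_type_algebra :: real ring"] that
    by (simp add: rat_adjoin_def a_inv_ring_of_type_algebra_real)
  show "inverse x \<in> rat_adjoin a" if "x \<in> rat_adjoin a" for x
  proof (cases "x = 0")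
    case True
    then show ?thesis using add[OF one uminus[OF one]] by simp
  next
    case False
    then show ?thesis using generate_field.m_inv[of x "ring_of_type_algebra :: real ring"] that
      by (simp add: rat_adjoin_def ring_of_type_algebra_real_simps m_inv_ring_of_type_algebra_real)
  qed
qed

lemma (in real_subfield) Rats_subset: "\<rat> \<subseteq> K"
proof
  have nat: "of_nat n \<in> K" for n by (induction n) auto
  have int: "of_int i \<in> K" for i
    using nat by (cases i rule: int_cases2) auto
  fix x :: real assume "x \<in> \<rat>"
  then obtain i j :: int where "x = of_int i / of_int j" by (auto elim: Rats_cases')
  then show "x \<in> K" using int by auto
qed

lemma rat_adjoin_Rats:
  assumes "a \<in> \<rat>"
  shows "rat_adjoin a = \<rat>"
proof
  show "\<rat> \<subseteq> rat_adjoin a" using real_subfield.Rats_subset real_subfield_rat_adjoin by blast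
  show "rat_adjoin a \<subseteq> \<rat>"
  proof
    fix x assume "x \<in> rat_adjoin a"
    then show "x \<in> \<rat>" unfolding rat_adjoin_def
      by induction (use assms in \<open>auto simp: ring_of_type_algebra_real_simps
        a_inv_ring_of_type_algebra_real m_inv_ring_of_type_algebra_real\<close>)
  qed
qed

section \<open>Constructing cosines of dyadic fractions of \<open>pi\<close>\<close>

text \<open>The points 0, 1, 1 + cis \<alpha>, cis \<alpha> form a rhombus; its diagonal from 0
  bisects the angle and meets the unit circle at the wanted point.\<close>

lemma cis_half_mem_constructible_points:
  assumes C: "0 \<in> constructible_points S" "1 \<in> constructible_points S" "cis \<alpha> \<in> constructible_points S"
    and \<alpha>: "0 < \<alpha>" "\<alpha> < pi"
  shows "cis (\<alpha> / 2) \<in> constructible_points S"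
proof -
  have c: "cos (\<alpha> / 2) > 0" using \<alpha> by (intro cos_gt_zero_pi) auto
  have rhombus: "1 + cis \<alpha> = (2 * cos (\<alpha> / 2)) *\<^sub>R cis (\<alpha> / 2)"
    using cos_double_cos[of "\<alpha> / 2"] sin_double[of "\<alpha> / 2"]
    by (simp add: complex_eq_iff power2_eq_square)
  have "1 + cis \<alpha> \<in> constructible_points S"
  proof (rule constructible_points.circle_circle[OF C(2) C(1) C(2) C(3) C(1) C(2)])
    show "sphere 1 (dist 0 (1::complex)) \<noteq> sphere (cis \<alpha>) (dist 0 (1::complex))"
    proof
      assume eq: "sphere 1 (dist 0 (1::complex)) = sphere (cis \<alpha>) (dist 0 (1::complex))"
      \<comment> \<open>The point 2 tells the two circles apart: lying on both would force cos
        \<alpha> = 1.\<close>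
      have "(2::complex) \<in> sphere 1 (dist 0 (1::complex))" by (simp add: mem_sphere_complex_iff del: mem_sphere)
      then have "(2 - cos \<alpha>)\<^sup>2 + (sin \<alpha>)\<^sup>2 = 1"
        unfolding eq by (simp add: mem_sphere_complex_iff del: mem_sphere)
      then have "cos \<alpha> = 1" using sin_cos_squared_add[of \<alpha>] by Groebner_Basis.algebra
      then have "sin \<alpha> = 0" using sin_cos_squared_add[of \<alpha>] by simp
      with \<alpha> sin_gt_zero[of \<alpha>] show False by simp
    qed
  qed (simp_all add: dist_norm)
  moreover have "1 + cis \<alpha> \<noteq> 0" using c by (simp add: rhombus)
  moreover have "cis (\<alpha> / 2) = 0 + (1 / (2 * cos (\<alpha> / 2))) *\<^sub>R (1 + cis \<alpha> - 0)"
    using c by (simp add: rhombus)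
  then have "cis (\<alpha> / 2) \<in> affine hull {0, 1 + cis \<alpha>}"
    unfolding affine_hull_pair_iff by blast
  ultimately show ?thesis
    using constructible_points.line_circle[of 0 S "1 + cis \<alpha>" 0 0 1 "cis (\<alpha> / 2)"] C
    by (auto simp: dist_norm)
qed

text \<open>The circles of radius 2 about 1 and -1 meet at \<i> sqrt 3, and the line from 0 through
  it meets the unit circle at \<i>.\<close>

lemma ii_mem_constructible_points:
  assumes C: "0 \<in> constructible_points S" "1 \<in> constructible_points S" "-1 \<in> constructible_points S"
  shows "\<i> \<in> constructible_points S"
proof -
  let ?w = "Complex 0 (sqrt 3)"
  have "?w \<in> constructible_points S"
  proof (rule constructible_points.circle_circle[OF C(2) C(2) C(3) C(3) C(2) C(3)])
    have "(3::complex) \<in> sphere 1 (dist 1 (-1::complex))"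
      "(3::complex) \<notin> sphere (-1) (dist 1 (-1::complex))"
      by (simp_all add: mem_sphere_complex_iff dist_norm del: mem_sphere)
    then show "sphere (1::complex) (dist 1 (-1::complex)) \<noteq> sphere (-1) (dist 1 (-1::complex))" by metis
  qed (simp_all add: mem_sphere_complex_iff dist_norm del: mem_sphere)
  moreover have "?w \<noteq> 0" by (simp add: complex_eq_iff)
  moreover have "\<i> = 0 + (1 / sqrt 3) *\<^sub>R (?w - 0)" by (simp add: complex_eq_iff)
  then have "\<i> \<in> affine hull {0, ?w}" unfolding affine_hull_pair_iff by blast
  ultimately show ?thesis
    using constructible_points.line_circle[of 0 S ?w 0 0 1 \<i>] C by (auto simp: dist_norm)
qed

text \<open>The circle about 1 through cis \<alpha> meets the unit circle again at the mirror image
  cis (-\<alpha>). The chord between the two crosses the real axis at cos \<alpha>.\<close>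

lemma cos_mem_constructible_points:
  assumes C: "0 \<in> constructible_points S" "1 \<in> constructible_points S" "cis \<alpha> \<in> constructible_points S"
    and \<alpha>: "0 < \<alpha>" "\<alpha> < pi"
  shows "complex_of_real (cos \<alpha>) \<in> constructible_points S"
proof -
  have s: "sin \<alpha> > 0" using \<alpha> by (rule sin_gt_zero)
  have "cis (- \<alpha>) \<in> constructible_points S"
  proof (rule constructible_points.circle_circle[OF C(1) C(1) C(2) C(2) C(2) C(3)])
    have "(-1::complex) \<in> sphere 0 (dist 0 (1::complex))" by simp
    moreover have "(-1::complex) \<notin> sphere 1 (dist 1 (cis \<alpha>))"
    proof
      assume "(-1::complex) \<in> sphere 1 (dist 1 (cis \<alpha>))"
      then have "dist 1 (cis \<alpha>) = 2" by (simp add: dist_norm)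
      then have "(1 - cos \<alpha>)\<^sup>2 + (sin \<alpha>)\<^sup>2 = 2\<^sup>2"
        by (metis cmod_power2 dist_norm minus_complex.simps one_complex.simps cis.simps
          power2_minus diff_0)
      then have "cos \<alpha> = -1" using sin_cos_squared_add[of \<alpha>] by Groebner_Basis.algebra
      then have "sin \<alpha> = 0" using sin_cos_squared_add[of \<alpha>] by simp
      with s show False by simp
    qed
    ultimately show "sphere (0::complex) (dist 0 (1::complex)) \<noteq> sphere 1 (dist 1 (cis \<alpha>))" by metis
    show "cis (- \<alpha>) \<in> sphere 1 (dist 1 (cis \<alpha>))"
      by (simp add: dist_norm cmod_def)
  qed (simp add: dist_norm)
  moreover have "cis \<alpha> \<noteq> cis (- \<alpha>)" using s by (simp add: complex_eq_iff)
  moreover have "complex_of_real (cos \<alpha>) = 0 + cos \<alpha> *\<^sub>R (1 - 0)"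
    by (simp add: complex_eq_iff)
  then have on_axis: "complex_of_real (cos \<alpha>) \<in> affine hull {0, 1}"
    unfolding affine_hull_pair_iff by blast
  moreover have "complex_of_real (cos \<alpha>) = cis \<alpha> + (1/2) *\<^sub>R (cis (- \<alpha>) - cis \<alpha>)"
    by (simp add: complex_eq_iff)
  then have "complex_of_real (cos \<alpha>) \<in> affine hull {cis \<alpha>, cis (- \<alpha>)}"
    unfolding affine_hull_pair_iff by blast
  moreover have "cis \<alpha> \<notin> affine hull {0, 1}"
    using s by (auto simp: affine_hull_pair_iff complex_eq_iff)
  then have "affine hull {0, 1} \<noteq> affine hull {cis \<alpha>, cis (- \<alpha>)}"
    by (metis hull_inc insertI1)
  ultimately show ?thesis
    using constructible_points.line_line[OF C(1,2) _ C(3)] by (metis zero_neq_one)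
qed

text \<open>Starts from \<i> = cis (pi / 2), built with the help of -1, and bisects k times; the
  exponent \<open>Suc k\<close> keeps every angle strictly between 0 and pi.\<close>

lemma constructible_over_cos_dyadic:
  assumes "-1 \<in> F"
  shows "constructible_over F (cos (pi / 2 ^ Suc k))"
proof -
  define S where "S = complex_of_real ` ({0, 1} \<union> F)"
  have C: "0 \<in> constructible_points S" "1 \<in> constructible_points S" "-1 \<in> constructible_points S"
    by (rule constructible_points.given, use assms in \<open>force simp: S_def\<close>)+
  have range: "0 < pi / 2 ^ Suc k" "pi / 2 ^ Suc k < pi" for k
    using one_less_power[of "2::real" "Suc k"] by (simp_all add: divide_less_eq)
  have "cis (pi / 2 ^ Suc k) \<in> constructible_points S"
  proof (induction k)
    case 0
    then show ?case using ii_mem_constructible_points[OF C] by simp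
  next
    case (Suc k)
    then show ?case
      using cis_half_mem_constructible_points[OF C(1,2) Suc range] by (simp add: mult.commute)
  qed
  then show ?thesis
    using cos_mem_constructible_points[OF C(1,2) _ range] by (simp add: constructible_over_def S_def)
qed

section \<open>Irrationality of the square root of 1/2, and assembly of both cases\<close>

lemma rational_square_ne_half:
  assumes "x \<in> \<rat>"
  shows "2 * x\<^sup>2 \<noteq> (1::real)"
proof
  assume x: "2 * x\<^sup>2 = 1"
  obtain i j :: nat where ij: "j \<noteq> 0" "\<bar>x\<bar> = real i / real j" "coprime i j"
    using assms by (rule Rats_abs_nat_div_natE)
  have "x\<^sup>2 = (real i / real j)\<^sup>2" unfolding ij(2)[symmetric] by simp
  with x ij(1) have "real (2 * i\<^sup>2) = real (j\<^sup>2)" by (simp add: field_simps)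
  then have eq: "2 * i\<^sup>2 = j\<^sup>2" by (simp only: of_nat_eq_iff)
  then have "even (j\<^sup>2)" by (metis dvd_triv_left)
  then have "even j" by simp
  then obtain k where "j = 2 * k" by (elim evenE)
  with eq have "i\<^sup>2 = 2 * k\<^sup>2" by (simp add: power_mult_distrib)
  then have "even (i\<^sup>2)" by simp
  then have "even i" by simp
  with \<open>even j\<close> show False using coprime_common_divisor[OF ij(3), of 2] by simp
qed

theorem theorem1p4:
  fixes m :: nat
  assumes "m > 0"
  shows "(even m \<longrightarrow>
           (\<exists>a::real. a \<in> \<rat> \<and> a \<in> {-1..1} \<and> rat_adjoin a = \<rat> \<and>
              (\<exists>x. poly (chebyshev_T m - [:a:]) x = 0 \<and> constructible_over (rat_adjoin a) x) \<and>
              \<not> (\<exists>x\<in>\<rat>. poly (chebyshev_T m - [:a:]) x = 0))) \<and>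
         (odd m \<longrightarrow>
           (\<forall>a::real. a \<in> {-1..1} \<longrightarrow>
              ((\<exists>x. poly (chebyshev_T m - [:a:]) x = 0 \<and> constructible_over (rat_adjoin a) x) \<longleftrightarrow>
               (\<exists>x\<in>rat_adjoin a. poly (chebyshev_T m - [:a:]) x = 0))))"
proof (intro conjI impI allI)
  assume "even m"
  have Q: "rat_adjoin 0 = \<rat>" by (rule rat_adjoin_Rats) simp
  interpret real_subfield "\<rat> :: real set" using real_subfield_rat_adjoin[of 0] Q by simp
  \<comment> \<open>Splitting off the power of 2 turns m times pi / 2^(e+1) into an odd multiple of
    pi / 2.\<close>
  obtain e n where en: "m = 2 ^ e * n" "odd n"
    using prime_power_canonical[OF two_is_prime_nat assms] by (auto simp: mult.commute)
  have "real m * (pi / 2 ^ Suc e) = real n * (pi / 2)" by (simp add: en)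
  then have "poly (chebyshev_T m) (cos (pi / 2 ^ Suc e)) = 0"
    unfolding poly_chebyshev_T_cos using cos_odd_mult_half_pi[OF en(2)] by (simp only:)
  moreover have "constructible_over \<rat> (cos (pi / 2 ^ Suc e))"
    by (rule constructible_over_cos_dyadic) auto
  moreover have "poly (chebyshev_T m) x \<noteq> 0" if "x \<in> \<rat>" for x
  proof -
    obtain h where "m = 2 * h" using \<open>even m\<close> by (elim evenE)
    then show ?thesis
      using rational_square_ne_half[OF poly_chebyshev_T_mem[OF that, of h]]
      by (simp add: chebyshev_T_double poly_power)
  qed
  ultimately show "\<exists>a::real. a \<in> \<rat> \<and> a \<in> {-1..1} \<and> rat_adjoin a = \<rat> \<and>
      (\<exists>x. poly (chebyshev_T m - [:a:]) x = 0 \<and> constructible_over (rat_adjoin a) x) \<and>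
      \<not> (\<exists>x\<in>\<rat>. poly (chebyshev_T m - [:a:]) x = 0)"
    by (intro exI[of _ 0]) (auto simp: Q)
next
  fix a :: real
  assume "odd m" and a: "a \<in> {-1..1}"
  note F = real_subfield_rat_adjoin[of a]
  show "(\<exists>x. poly (chebyshev_T m - [:a:]) x = 0 \<and> constructible_over (rat_adjoin a) x) \<longleftrightarrow>
      (\<exists>x\<in>rat_adjoin a. poly (chebyshev_T m - [:a:]) x = 0)"
  proof
    assume "\<exists>x. poly (chebyshev_T m - [:a:]) x = 0 \<and> constructible_over (rat_adjoin a) x"
    then obtain x where x: "poly (chebyshev_T m) x = a" "x \<in> quadratic_closure (rat_adjoin a)"
      using constructible_over_mem_quadratic_closure[OF F] by auto
    then obtain K where "quadratic_tower (rat_adjoin a) K" "x \<in> K"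
      by (auto simp: quadratic_closure_def)
    then show "\<exists>x\<in>rat_adjoin a. poly (chebyshev_T m - [:a:]) x = 0"
      using quadratic_tower_chebyshev_T_zero_descent[OF _ F \<open>odd m\<close> mem_rat_adjoin, of K] x a
      by (auto simp: abs_le_iff)
  next
    assume "\<exists>x\<in>rat_adjoin a. poly (chebyshev_T m - [:a:]) x = 0"
    then show "\<exists>x. poly (chebyshev_T m - [:a:]) x = 0 \<and> constructible_over (rat_adjoin a) x"
      \<comment> \<open>Elements of the base field are among the given points.\<close>
      by (auto simp: constructible_over_def intro!: constructible_points.given)
  qed
qed

end
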